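(* Let $1\le n\le N$, let $B\in\mathbb{C}^{N\times N}$ be a Hermitian negative definite matrix ($B\prec 0$), and let $V\in\mathbb{C}^{N\times n}$ be a matrix with linearly independent columns. Then the adaptive compression $\underline{B}[V]$ is the unique rank-$n$ Hermitian $N\times N$ matrix that agrees with $B$ on $\mathrm{span}\,V$ (that is, the unique Hermitian matrix $B'$ of rank $n$ with $B'v=Bv$ for all $v\in\mathrm{span}\,V$). Furthermore, $B\preceq \underline{B}[V]\preceq 0$.
   Context: $\mathrm{span}\,V$ denotes the column span of $V$. For Hermitian matrices, $X\preceq Y$ means $Y-X$ is positive semidefinite, and $X\prec Y$ means $Y-X$ is positive definite. For $B\prec 0$ Hermitian and $V\in\mathbb{C}^{N\times n}$ with linearly independent columns, put $W=BV$; the matrix $W^*V=V^*BV$ is negative definite, hence invertible, and the adaptive compression of $B$ is $$\underline{B}[V]=W(W^*V)^{-1}W^*=BV(V^*BV)^{-1}V^*B .$$ *)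

theory Defs
  imports "HOL-Analysis.Analysis"
begin

text \<open>An \<open>N \<times> n\<close> complex matrix is an element of \<^typ>\<open>complex^'n^'N\<close>: the outer
  index is the row index.  Span, independence and dimension over the complex numbers are the
  constants of the interpretation \<open>vec\<close>; the unqualified ones are over the reals.\<close>

definition adj :: "complex^'n^'m \<Rightarrow> complex^'m^'n"
  where "adj A = (\<chi> i j. cnj (A $ j $ i))"

definition hermitian :: "complex^'n^'n \<Rightarrow> bool"
  where "hermitian A \<longleftrightarrow> adj A = A"

definition cinner :: "complex^'n \<Rightarrow> complex^'n \<Rightarrow> complex"
  where "cinner x y = (\<Sum>i\<in>UNIV. cnj (x $ i) * y $ i)"

text \<open>For Hermitian \<open>A\<close> the number \<open>x\<^sup>* A x\<close> is real, so taking its real part loses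
  nothing.\<close>

definition pos_semidef :: "complex^'n^'n \<Rightarrow> bool"
  where "pos_semidef A \<longleftrightarrow> hermitian A \<and> (\<forall>x. 0 \<le> Re (cinner x (A *v x)))"

definition pos_def :: "complex^'n^'n \<Rightarrow> bool"
  where "pos_def A \<longleftrightarrow> hermitian A \<and> (\<forall>x. x \<noteq> 0 \<longrightarrow> 0 < Re (cinner x (A *v x)))"

definition loewner_le :: "complex^'n^'n \<Rightarrow> complex^'n^'n \<Rightarrow> bool"  (infix "\<preceq>\<^sub>L" 50)
  where "X \<preceq>\<^sub>L Y \<longleftrightarrow> pos_semidef (Y - X)"

definition loewner_less :: "complex^'n^'n \<Rightarrow> complex^'n^'n \<Rightarrow> bool"  (infix "\<prec>\<^sub>L" 50)
  where "X \<prec>\<^sub>L Y \<longleftrightarrow> pos_def (Y - X)"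

text \<open>\<^const>\<open>columns\<close> is a set, so independence of the columns as a family also needs them
  to be pairwise distinct.\<close>

definition lin_indep_columns :: "complex^'n^'m \<Rightarrow> bool"
  where "lin_indep_columns V \<longleftrightarrow> inj (\<lambda>j. column j V) \<and> vec.independent (columns V)"

definition col_span :: "complex^'n^'m \<Rightarrow> (complex^'m) set"
  where "col_span V = vec.span (columns V)"

definition adaptive_compression :: "complex^'m^'m \<Rightarrow> complex^'n^'m \<Rightarrow> complex^'m^'m"
  where "adaptive_compression B V =
    (let W = B ** V in W ** matrix_inv (adj W ** V) ** adj W)"

text \<open>\<^const>\<open>matrix_inv\<close> is only meaningful on invertible matrices.  The lemma
  \<open>invertible_compressed\<close> below shows that the matrix inverted in
  \<^const>\<open>adaptive_compression\<close> is one.\<close>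

lemma adj_mult: "adj (A ** B) = adj B ** adj A"
  by (simp add: adj_def matrix_matrix_mult_def vec_eq_iff mult.commute)

lemma cinner_adj: "cinner x (adj A *v y) = cinner (A *v x) y"
proof -
  have "cinner x (adj A *v y) = (\<Sum>i\<in>UNIV. \<Sum>j\<in>UNIV. cnj (x $ i) * (cnj (A $ j $ i) * y $ j))"
    by (simp add: cinner_def adj_def matrix_vector_mult_def sum_distrib_left)
  also have "\<dots> = (\<Sum>j\<in>UNIV. \<Sum>i\<in>UNIV. cnj (x $ i) * (cnj (A $ j $ i) * y $ j))"
    by (rule sum.swap)
  also have "\<dots> = cinner (A *v x) y"
    by (simp add: cinner_def matrix_vector_mult_def sum_distrib_left sum_distrib_right mult_ac)
  finally show ?thesis .
qed

lemma lin_indep_columns_ker: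
  assumes "lin_indep_columns V" and "V *v x = 0"
  shows "x = 0"
proof -
  have inj: "inj (\<lambda>j. column j V)" and ind: "vec.independent (columns V)"
    using assms(1) by (auto simp: lin_indep_columns_def)
  have cols: "columns V = range (\<lambda>j. column j V)"
    by (auto simp: columns_def)
  have inv_col: "inv (\<lambda>j. column j V) (column j V) = j" for j
    using inv_f_f[OF inj, of j] by simp
  let ?u = "\<lambda>w. x $ (inv (\<lambda>j. column j V) w)"
  have "(\<Sum>w\<in>columns V. ?u w *s w) = (\<Sum>j\<in>UNIV. x $ j *s column j V)"
    unfolding cols using inj by (subst sum.reindex) (simp_all add: inv_col)
  also have "\<dots> = 0"
    using assms(2) by (simp add: matrix_mult_sum)
  finally have "\<forall>w\<in>columns V. ?u w = 0"
    using ind vec.independentD[of "columns V" "columns V" ?u] by (simp add: cols)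
  then show ?thesis
    by (simp add: cols vec_eq_iff inv_col)
qed

lemma invertible_compressed:
  assumes "B \<prec>\<^sub>L 0" and "lin_indep_columns V"
  shows "invertible (adj (B ** V) ** V)"
proof -
  have pd: "pos_def (- B)"
    using assms(1) by (simp add: loewner_less_def)
  have neg: "(- B) *v y = - (B *v y)" for y
    by (simp add: matrix_vector_mult_def vec_eq_iff sum_negf)
  have herm: "adj B = B"
    using pd by (simp add: pos_def_def hermitian_def adj_def vec_eq_iff)
  have "x = 0" if "(adj (B ** V) ** V) *v x = 0" for x
  proof -
    have "cinner (V *v x) (B *v (V *v x)) = cinner x ((adj (B ** V) ** V) *v x)"
      by (simp add: adj_mult herm cinner_adj flip: matrix_vector_mul_assoc)
    also have "\<dots> = 0"
      using that by (simp add: cinner_def)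
    finally have "Re (cinner (V *v x) ((- B) *v (V *v x))) = 0"
      unfolding neg by (simp add: cinner_def sum_negf)
    then have "V *v x = 0"
      using pd unfolding pos_def_def by (metis less_irrefl)
    then show "x = 0"
      using assms(2) lin_indep_columns_ker by blast
  qed
  then show ?thesis
    unfolding invertible_left_inverse matrix_left_invertible_ker by blast
qed

end

theory Submission
  imports Defs
begin

text \<open>Write \<open>W = B V\<close>, \<open>M = W\<^sup>* V = V\<^sup>* B V\<close> and \<open>A = W M\<inverse> W\<^sup>*\<close>, the adaptive
  compression.  Since \<open>M\<close> is Hermitian and invertible, \<open>A\<close> is Hermitian and \<open>A V = W = B V\<close>,
  so \<open>A\<close> agrees with \<open>B\<close> on the column span of \<open>V\<close>.

  Rank and uniqueness both come from comparing row spaces.  If \<open>B'\<close> is Hermitian and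
  \<open>B' V = W\<close>, then taking adjoints gives \<open>V\<^sup>* B' = W\<^sup>*\<close>, so the row space of \<open>B'\<close> contains
  that of \<open>W\<^sup>*\<close>, whose dimension is \<open>n\<close> because \<open>V M\<inverse>\<close> is a right inverse of \<open>W\<^sup>*\<close>.  For
  \<open>B' = A\<close> the reverse inclusion is read off from the definition, so \<open>A\<close> has rank \<open>n\<close>.  For
  any \<open>B'\<close> of rank \<open>n\<close> the two row spaces coincide by dimension, so \<open>B' = X W\<^sup>*\<close> for some
  \<open>X\<close>; now \<open>W = B' V = X M\<close> forces \<open>X = W M\<inverse>\<close>, that is, \<open>B' = A\<close>.

  For the order relations put \<open>P = V M\<inverse> W\<^sup>*\<close>, the projection onto the span of \<open>V\<close> that is
  orthogonal for the definite form \<open>(x, y) \<mapsto> - x\<^sup>* B y\<close>.  The compression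
  evaluates the form of \<open>B\<close> on the projected vectors, \<open>A = B P = P\<^sup>* B P\<close>, and by Pythagoras
  \<open>B - A = (I - P)\<^sup>* B (I - P)\<close>.  Both are of the form \<open>C\<^sup>* B C\<close>, and such products
  inherit \<open>\<preceq> 0\<close> from \<open>B\<close>.\<close>

section \<open>Row spaces and rank\<close>

lemma linear_vector_matrix_mult: "Vector_Spaces.linear (*s) (*s) (\<lambda>y. y v* A)"
  for A :: "'a::field^'n^'m"
proof -
  have "(\<lambda>y. y v* A) = (*v) (transpose A)"
    by (simp add: fun_eq_iff)
  then show ?thesis
    using matrix_vector_mul_linear_gen by metis
qed

lemma subspace_row_space: "vec.subspace (range (\<lambda>y. y v* A))"
  for A :: "'a::field^'n^'m"
  using linear_vector_matrix_mult vec.subspace_UNIV by (rule vec.linear_subspace_image)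

lemma span_columns_eq_range: "vec.span (columns A) = range ((*v) A)"
  for A :: "'a::field^'n^'m"
proof
  show "range ((*v) A) \<subseteq> vec.span (columns A)"
    using matrix_vector_mult_in_columnspace_gen by blast
  have "column j A = A *v axis j 1" for j
    by (simp add: vec_eq_iff column_def matrix_vector_mult_def axis_def if_distrib cong: if_cong)
  then have "columns A \<subseteq> range ((*v) A)"
    by (auto simp: columns_def)
  moreover have "vec.subspace (range ((*v) A))"
    by (intro vec.linear_subspace_image matrix_vector_mul_linear_gen vec.subspace_UNIV)
  ultimately show "vec.span (columns A) \<subseteq> range ((*v) A)"
    by (rule vec.span_minimal)
qed

lemma rank_eq_dim_row_space: "rank A = vec.dim (range (\<lambda>y. y v* A))"
  for A :: "'a::field^'n^'m"
proof -
  have "vec.span (rows A) = range (\<lambda>y. y v* A)"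
    using span_columns_eq_range[of "transpose A"] by (simp add: columns_transpose)
  then show ?thesis
    unfolding row_rank_def_gen by (metis vec.dim_span)
qed

text \<open>Each row of \<open>K A\<close> is a combination of rows of \<open>A\<close>.  Both the rank of the
  compression and its uniqueness rest on comparing row spaces in this way.\<close>

lemma row_space_mult_subset: "range (\<lambda>y. y v* (K ** A)) \<subseteq> range (\<lambda>y. y v* A)"
  for A :: "'a::field^'n^'m"
  by (auto simp flip: vector_matrix_mul_assoc)

lemma rank_mult_le_right: "rank (K ** A) \<le> rank A"
  for A :: "'a::field^'n^'m"
  unfolding rank_eq_dim_row_space by (rule vec.dim_subset[OF row_space_mult_subset])

lemma rank_right_invertible:
  fixes A :: "'a::field^'n^'m"
  assumes "A ** R = mat 1"
  shows "rank A = CARD('m)"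
proof -
  have "inj (\<lambda>y. y v* A)"
    by (rule inj_on_inverseI[where g = "\<lambda>z. z v* R"]) (simp add: vector_matrix_mul_assoc assms)
  then have "vec.dim (range (\<lambda>y. y v* A)) = vec.dim (UNIV :: ('a^'m) set)"
    by (intro vec.dim_image_eq linear_vector_matrix_mult) simp
  then show ?thesis
    by (simp only: rank_eq_dim_row_space vec_dim_card)
qed

text \<open>A left multiple whose rank has not dropped has the same row space, so the multiplication
  can be undone from the left.\<close>

lemma left_factor_if_rank_le:
  fixes A :: "'a::field^'n^'m" and K :: "'a^'m^'k"
  assumes "rank A \<le> rank (K ** A)"
  obtains X where "A = X ** (K ** A)"
proof -
  let ?C = "K ** A"
  have "range (\<lambda>y. y v* ?C) = range (\<lambda>y. y v* A)"
    using assms unfolding rank_eq_dim_row_space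
    by (intro vec.subspace_dim_equal row_space_mult_subset subspace_row_space)
  then have "\<forall>i. \<exists>x. axis i 1 v* A = x v* ?C"
    by blast
  then obtain f where f: "\<And>i. axis i 1 v* A = f i v* ?C"
    using choice[of "\<lambda>i x. axis i 1 v* A = x v* ?C"] by blast
  have "A $ i = axis i 1 v* A" for i
    by (simp add: vec_eq_iff vector_matrix_mult_def axis_def if_distrib if_distribR cong: if_cong)
  moreover have "((\<chi> i. f i) ** ?C) $ i = f i v* ?C" for i
    by (simp add: vec_eq_iff vector_matrix_mult_def matrix_matrix_mult_def)
  ultimately have "A $ i = ((\<chi> i. f i) ** ?C) $ i" for i
    by (simp only: f)
  then have "A = (\<chi> i. f i) ** ?C"
    by (rule vec_eq_iff[THEN iffD2, OF allI])
  then show thesis ..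
qed

section \<open>Adjoints and congruence\<close>

lemma matrix_diff_ldistrib: "A ** (B - C) = A ** B - A ** C"
  for A :: "'a::ring_1^'n^'m"
  by (simp add: vec_eq_iff matrix_matrix_mult_def right_diff_distrib sum_subtractf)

lemma matrix_diff_rdistrib: "(A - B) ** C = A ** C - B ** C"
  for A :: "'a::ring_1^'n^'m"
  by (simp add: vec_eq_iff matrix_matrix_mult_def left_diff_distrib sum_subtractf)

lemma adj_adj [simp]: "adj (adj A) = A"
  by (simp add: adj_def vec_eq_iff)

lemma adj_diff: "adj (A - B) = adj A - adj B"
  by (simp add: adj_def vec_eq_iff)

lemma adj_mat_one [simp]: "adj (mat 1) = mat 1"
  by (simp add: adj_def mat_def vec_eq_iff)

lemma hermitian_congruence:
  assumes "hermitian S"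
  shows "hermitian (adj C ** S ** C)"
  using assms by (simp add: hermitian_def adj_mult matrix_mul_assoc)

lemma pos_semidef_congruence:
  assumes "pos_semidef S"
  shows "pos_semidef (adj C ** S ** C)"
proof -
  have "cinner x ((adj C ** S ** C) *v x) = cinner (C *v x) (S *v (C *v x))" for x
    by (simp add: cinner_adj flip: matrix_vector_mul_assoc)
  then show ?thesis
    using assms by (simp add: pos_semidef_def hermitian_congruence)
qed

lemma loewner_le_congruence:
  assumes "X \<preceq>\<^sub>L Y"
  shows "adj C ** X ** C \<preceq>\<^sub>L adj C ** Y ** C"
  using pos_semidef_congruence[of "Y - X" C] assms
  by (simp add: loewner_le_def matrix_diff_ldistrib matrix_diff_rdistrib)

lemma loewner_less_imp_le:
  assumes "X \<prec>\<^sub>L Y"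
  shows "X \<preceq>\<^sub>L Y"
proof -
  have "0 \<le> Re (cinner x ((Y - X) *v x))" for x
    using assms by (cases "x = 0")
      (auto simp: loewner_less_def pos_def_def cinner_def intro: less_imp_le)
  then show ?thesis
    using assms by (simp add: loewner_less_def loewner_le_def pos_def_def pos_semidef_def)
qed

lemma hermitian_inverse:
  assumes "hermitian M" and "M ** M' = mat 1"
  shows "hermitian M'"
proof -
  have "adj M' ** M = mat 1"
    using assms by (metis adj_mult adj_mat_one hermitian_def)
  then have "adj M' = M'"
    using assms(2) by (metis matrix_mul_assoc matrix_mul_lid matrix_mul_rid)
  then show ?thesis
    by (simp add: hermitian_def)
qed

lemma agree_on_col_span_iff:
  "(\<forall>v\<in>col_span V. A *v v = B *v v) \<longleftrightarrow> A ** V = B ** V"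
  unfolding matrix_eq[of "A ** V"] matrix_vector_mul_assoc[symmetric]
    col_span_def span_columns_eq_range by blast

section \<open>The adaptive compression\<close>

theorem theorem1p1:
  fixes B :: "complex^'N^'N" and V :: "complex^'n^'N"
  assumes "CARD('n) \<le> CARD('N)"
    and "hermitian B" and "B \<prec>\<^sub>L 0"
    and "lin_indep_columns V"
  shows "hermitian (adaptive_compression B V)
      \<and> rank (adaptive_compression B V) = CARD('n)
      \<and> (\<forall>v\<in>col_span V. adaptive_compression B V *v v = B *v v)
      \<and> (\<forall>B'. hermitian B' \<and> rank B' = CARD('n) \<and> (\<forall>v\<in>col_span V. B' *v v = B *v v)
            \<longrightarrow> B' = adaptive_compression B V)
      \<and> B \<preceq>\<^sub>L adaptive_compression B V \<and> adaptive_compression B V \<preceq>\<^sub>L 0"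
proof -
  define W where "W = B ** V"
  define M where "M = adj W ** V"
  define M' where "M' = matrix_inv M"
  define A where "A = adaptive_compression B V"
  define P where "P = V ** M' ** adj W"

  have "invertible M"
    unfolding M_def W_def using assms(3,4) by (rule invertible_compressed)
  then have "M ** M' = mat 1 \<and> M' ** M = mat 1"
    unfolding invertible_def M'_def matrix_inv_def by (rule someI_ex)
  then have MM': "M ** M' = mat 1" and M'M: "M' ** M = mat 1"
    by auto
  have A_eq: "A = W ** M' ** adj W"
    by (simp add: A_def adaptive_compression_def Let_def W_def M_def M'_def)
  have adj_B: "adj B = B"
    using assms(2) by (simp add: hermitian_def)

  have "M = adj V ** B ** V"
    by (simp add: M_def W_def adj_mult adj_B)
  then have "hermitian M"
    using assms(2) by (simp add: hermitian_congruence)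
  then have "hermitian M'"
    using MM' by (rule hermitian_inverse)
  then have herm_A: "hermitian A"
    using hermitian_congruence[of M' "adj W"] by (simp add: A_eq)

  have "A ** V = W ** (M' ** M)"
    by (simp add: A_eq M_def matrix_mul_assoc)
  then have AV: "A ** V = W"
    by (simp add: M'M)

  have "adj W ** (V ** M') = mat 1"
    using MM' by (simp add: M_def matrix_mul_assoc)
  then have rank_W: "rank (adj W) = CARD('n)"
    by (rule rank_right_invertible)

  have adj_V_mult: "adj V ** B' = adj W" if "hermitian B'" "B' ** V = W" for B'
    using that by (metis adj_mult hermitian_def)

  have "rank A \<le> rank (adj W)"
    unfolding A_eq by (rule rank_mult_le_right)
  moreover have "rank (adj W) \<le> rank A"
    using adj_V_mult[OF herm_A AV] rank_mult_le_right by metis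
  ultimately have rank_A: "rank A = CARD('n)"
    using rank_W by simp

  \<comment> \<open>\<open>B'\<close> loses no rank when multiplied by \<open>V\<^sup>*\<close>, so it factors through \<open>W\<^sup>*\<close>; evaluating the
    factorization on \<open>V\<close> determines the other factor.\<close>
  have unique: "B' = A" if "hermitian B'" "rank B' = CARD('n)" "B' ** V = W" for B'
  proof -
    have "rank B' \<le> rank (adj V ** B')"
      using that adj_V_mult rank_W by simp
    then obtain X where "B' = X ** (adj V ** B')"
      by (rule left_factor_if_rank_le)
    then have X: "B' = X ** adj W"
      using that adj_V_mult by simp
    then have "W = X ** M"
      using that(3) by (simp add: M_def matrix_mul_assoc)
    then have "W ** M' = X ** (M ** M')"
      by (simp add: matrix_mul_assoc)
    then show "B' = A"
      by (simp add: X A_eq MM')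
  qed

  have BP: "B ** P = A"
    by (simp add: P_def A_eq W_def matrix_mul_assoc)
  then have PB: "adj P ** B = A"
    using herm_A adj_B by (metis adj_mult hermitian_def)
  have AP: "A ** P = A"
    using AV by (simp add: P_def A_eq matrix_mul_assoc)

  have "B \<preceq>\<^sub>L 0"
    using assms(3) by (rule loewner_less_imp_le)
  then have congr: "adj C ** B ** C \<preceq>\<^sub>L 0" for C :: "complex^'N^'N"
    using loewner_le_congruence[of B 0 C] by simp
  have "A \<preceq>\<^sub>L 0"
    using congr[of P] by (simp add: PB AP)
  \<comment> \<open>Pythagoras for the complementary projection: both cross terms and the term
    \<open>P\<^sup>* B P\<close> equal \<open>A\<close>, so a single \<open>- A\<close> survives.\<close>
  moreover have "adj (mat 1 - P) ** B ** (mat 1 - P) = B - A"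
    by (simp add: adj_diff matrix_diff_ldistrib matrix_diff_rdistrib BP PB AP)
  then have "B - A \<preceq>\<^sub>L 0"
    using congr[of "mat 1 - P"] by simp
  then have "B \<preceq>\<^sub>L A"
    by (simp add: loewner_le_def)
  ultimately show ?thesis
    using herm_A rank_A AV unique unfolding agree_on_col_span_iff A_def W_def by blast
qed

end
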